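(* Let $m\ge 1$ be an integer, let $E,F$ be Banach spaces over $\mathbb{K}=\mathbb{R}$ or $\mathbb{C}$, and let $1\le t,s<\infty$ with $t\ge \frac{s}{m}$. Suppose that $\mathcal{P}(^mE;F)=\mathcal{P}_{(t,s)}(^mE;F)$, i.e. every continuous $m$-homogeneous polynomial from $E$ to $F$ is absolutely $(t,s)$-summing. Then for real numbers $p,q$: (a) If $0<p\le t$ and $0<s\le q$, then $\eta^{m-pol}_{(p,q)}(E;F)\le \frac{1}{p}-\frac{1}{t}+\frac{m}{s}-\frac{m}{q}$. (b) If $0<p\le t$ and $0<q\le s$, then $\eta^{m-pol}_{(p,q)}(E;F)\le \frac{1}{p}-\frac{1}{t}$. (c) If $0<t\le p$ and $0<s\le q$, then $\eta^{m-pol}_{(p,q)}(E;F)\le \frac{m}{s}-\frac{m}{q}$. (d) If $0<t\le p$ and $0<q\le s$, then $\eta^{m-pol}_{(p,q)}(E;F)=0$.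
   Context: $\mathcal{P}(^mE;F)$ is the space of continuous $m$-homogeneous polynomials from $E$ to $F$. For $0<q<\infty$ and $x_1,\dots,x_n\in E$, put $\|(x_k)_{k=1}^n\|_{w,q}=\sup_{\varphi\in B_{E^*}}\big(\sum_{k=1}^n|\varphi(x_k)|^q\big)^{1/q}$, where $B_{E^*}$ is the closed unit ball of the dual $E^*$. For $1\le t,s<\infty$ with $t\ge s/m$, $P\in\mathcal{P}(^mE;F)$ is absolutely $(t,s)$-summing if there is $C\ge 0$ with $\big(\sum_{k=1}^n\|P(x_k)\|^t\big)^{1/t}\le C\,\|(x_k)_{k=1}^n\|_{w,s}^m$ for all positive integers $n$ and all $x_1,\dots,x_n\in E$. The set of these polynomials is $\mathcal{P}_{(t,s)}(^mE;F)$. For $0<p,q<\infty$, the polynomial $m$-index of $(p,q)$-summability $\eta^{m-pol}_{(p,q)}(E;F)$ is the infimum of all $\sigma\ge0$ such that for every $P\in\mathcal{P}(^mE;F)$ there is a constant $C\ge0$ (not depending on $n$ or on the vectors) with $$\Big(\sum_{j=1}^n\|P(x_j)\|^p\Big)^{1/p}\le C\,n^{\sigma}\,\|(x_j)_{j=1}^n\|_{w,q}^m$$ for all positive integers $n$ and all $x_1,\dots,x_n\in E$. *)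

theory Defs
  imports "HOL-Analysis.Analysis"
begin

text \<open>
  Banach spaces over \<open>\<K> = \<real>\<close> or \<open>\<C>\<close>. The scalars are a type of class \<open>real_normed_field\<close>; its
  instances include \<open>real\<close> and \<open>complex\<close>, and by the Gelfand--Mazur and Ostrowski theorems every
  instance is isometrically isomorphic to one of these. A normed space over \<open>\<K>\<close> is a type of class
  \<open>real_normed_vector\<close> (a Banach space: of class \<open>banach\<close>) with an explicit scalar
  multiplication by \<open>\<K>\<close>, whose restriction to \<open>\<real>\<close> is the one of the class.
\<close>

locale normed_space_over = vector_space scale
  for scale :: "'k::real_normed_field \<Rightarrow> 'e::real_normed_vector \<Rightarrow> 'e" +
  assumes norm_scale: "norm (scale c x) = norm c * norm x"
    and scale_of_real: "scale (of_real r) x = r *\<^sub>R x"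

definition dual_space :: "('k::real_normed_field \<Rightarrow> 'e::real_normed_vector \<Rightarrow> 'e) \<Rightarrow> ('e \<Rightarrow> 'k) set" where
  "dual_space scE = {\<phi>. Vector_Spaces.linear scE (*) \<phi> \<and> bounded_linear \<phi>}"

definition dual_unit_ball :: "('k::real_normed_field \<Rightarrow> 'e::real_normed_vector \<Rightarrow> 'e) \<Rightarrow> ('e \<Rightarrow> 'k) set" where
  "dual_unit_ball scE = {\<phi> \<in> dual_space scE. onorm \<phi> \<le> 1}"

text \<open>
  A finite family \<open>x\<^sub>1, \<dots>, x\<^sub>n\<close> is given by \<open>n\<close> and a function on \<open>nat\<close> of which only the values
  on \<open>{1..n}\<close> are used. For \<open>q > 0\<close> the supremum is over a nonempty set bounded above.
\<close>

definition weak_norm ::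
  "('k::real_normed_field \<Rightarrow> 'e::real_normed_vector \<Rightarrow> 'e) \<Rightarrow> real \<Rightarrow> nat \<Rightarrow> (nat \<Rightarrow> 'e) \<Rightarrow> real" where
  "weak_norm scE q n x =
     (SUP \<phi>\<in>dual_unit_ball scE. (\<Sum>k=1..n. norm (\<phi> (x k)) powr q) powr (1 / q))"

text \<open>
  An \<open>m\<close>-linear map takes its \<open>m\<close> arguments as the values at \<open>0, \<dots>, m - 1\<close> of a function on \<open>nat\<close>;
  the first conjunct says that the other values are irrelevant.
\<close>

definition multilinear_map ::
  "('k::real_normed_field \<Rightarrow> 'e::real_normed_vector \<Rightarrow> 'e) \<Rightarrow> ('k \<Rightarrow> 'f::real_normed_vector \<Rightarrow> 'f) \<Rightarrow>
   nat \<Rightarrow> ((nat \<Rightarrow> 'e) \<Rightarrow> 'f) \<Rightarrow> bool" where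
  "multilinear_map scE scF m A \<longleftrightarrow>
     (\<forall>v w. (\<forall>i<m. v i = w i) \<longrightarrow> A v = A w) \<and>
     (\<forall>v. \<forall>i<m. Vector_Spaces.linear scE scF (\<lambda>y. A (v(i := y))))"

definition homogeneous_polynomial ::
  "('k::real_normed_field \<Rightarrow> 'e::real_normed_vector \<Rightarrow> 'e) \<Rightarrow> ('k \<Rightarrow> 'f::real_normed_vector \<Rightarrow> 'f) \<Rightarrow>
   nat \<Rightarrow> ('e \<Rightarrow> 'f) \<Rightarrow> bool" where
  "homogeneous_polynomial scE scF m P \<longleftrightarrow>
     (\<exists>A. multilinear_map scE scF m A \<and> (\<forall>x. P x = A (\<lambda>_. x)))"

definition cont_hom_polys ::
  "('k::real_normed_field \<Rightarrow> 'e::real_normed_vector \<Rightarrow> 'e) \<Rightarrow> ('k \<Rightarrow> 'f::real_normed_vector \<Rightarrow> 'f) \<Rightarrow>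
   nat \<Rightarrow> ('e \<Rightarrow> 'f) set" where
  "cont_hom_polys scE scF m = {P. homogeneous_polynomial scE scF m P \<and> continuous_on UNIV P}"

definition summing_polys ::
  "('k::real_normed_field \<Rightarrow> 'e::real_normed_vector \<Rightarrow> 'e) \<Rightarrow> ('k \<Rightarrow> 'f::real_normed_vector \<Rightarrow> 'f) \<Rightarrow>
   nat \<Rightarrow> real \<Rightarrow> real \<Rightarrow> ('e \<Rightarrow> 'f) set" where
  "summing_polys scE scF m t s =
     {P \<in> cont_hom_polys scE scF m.
        \<exists>C\<ge>0. \<forall>n\<ge>1. \<forall>x. (\<Sum>k=1..n. norm (P (x k)) powr t) powr (1 / t) \<le> C * weak_norm scE s n x ^ m}"

text \<open>
  For \<open>p, q > 0\<close> the set below contains \<open>1 / p\<close>, because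
  \<open>norm (P x) \<le> C * norm x ^ m\<close> for some \<open>C\<close>; so the infimum is over a nonempty set.
\<close>

definition pol_index ::
  "('k::real_normed_field \<Rightarrow> 'e::real_normed_vector \<Rightarrow> 'e) \<Rightarrow> ('k \<Rightarrow> 'f::real_normed_vector \<Rightarrow> 'f) \<Rightarrow>
   nat \<Rightarrow> real \<Rightarrow> real \<Rightarrow> real" where
  "pol_index scE scF m p q =
     Inf {\<sigma>. \<sigma> \<ge> 0 \<and>
       (\<forall>P\<in>cont_hom_polys scE scF m. \<exists>C\<ge>0. \<forall>n\<ge>1. \<forall>x.
          (\<Sum>j=1..n. norm (P (x j)) powr p) powr (1 / p) \<le> C * real n powr \<sigma> * weak_norm scE q n x ^ m)}"

end

theory Submission
  imports Defs
begin

text \<open>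
  On \<open>n\<close> coordinates, replacing the exponent \<open>t\<close> by \<open>p\<close> costs at most the factor
  \<open>n\<close> to the power \<open>max 0 (1/p - 1/t)\<close>. Applied to \<open>norm (P (x j))\<close> this passes from \<open>p\<close> to \<open>t\<close>;
  applied under the supremum to \<open>norm (\<phi> (x j))\<close> it passes from the weak \<open>s\<close>-norm to the weak \<open>q\<close>-norm.
  Between the two stands the hypothesis, so \<open>max 0 (1/p - 1/t) + m max 0 (1/s - 1/q)\<close> is an
  admissible exponent in all four cases.
\<close>

text \<open>Split off one factor, \<open>u i powr r = u i * u i powr (r - 1)\<close>, and bound the
  other by the same power of the whole sum, which dominates each term.\<close>

lemma sum_powr_le_powr_sum:
  fixes u :: "'i \<Rightarrow> real"
  assumes "finite A" and nonneg: "\<And>i. i \<in> A \<Longrightarrow> 0 \<le> u i" and "1 \<le> r"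
  shows "(\<Sum>i\<in>A. u i powr r) \<le> (\<Sum>i\<in>A. u i) powr r"
proof -
  let ?S = "\<Sum>i\<in>A. u i"
  have powr_split: "x powr r = x * x powr (r - 1)" if "0 \<le> x" for x :: real
    using that powr_mult_base[of x "r - 1"] by simp
  have "(\<Sum>i\<in>A. u i powr r) \<le> (\<Sum>i\<in>A. u i * ?S powr (r - 1))"
  proof (rule sum_mono)
    fix i assume "i \<in> A"
    then have "u i \<le> ?S"
      using assms by (intro member_le_sum) auto
    then have "u i powr (r - 1) \<le> ?S powr (r - 1)"
      using nonneg[OF \<open>i \<in> A\<close>] \<open>1 \<le> r\<close> by (intro powr_mono2) auto
    then show "u i powr r \<le> u i * ?S powr (r - 1)"
      using nonneg[OF \<open>i \<in> A\<close>] by (simp add: powr_split mult_left_mono)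
  qed
  also have "\<dots> = ?S powr r"
    using powr_split[of ?S] nonneg by (simp add: sum_nonneg sum_distrib_right)
  finally show ?thesis .
qed

lemma powr_sum_le_sum_powr:
  fixes u :: "'i \<Rightarrow> real"
  assumes "finite A" and nonneg: "\<And>i. i \<in> A \<Longrightarrow> 0 \<le> u i" and "1 \<le> r"
  shows "(\<Sum>i\<in>A. u i) powr r \<le> real (card A) powr (r - 1) * (\<Sum>i\<in>A. u i powr r)"
proof -
  \<comment> \<open>Jensen's inequality is applied on the support of \<open>u\<close>, since \<open>powr_convex\<close> excludes the point 0.\<close>
  define B where "B = {i \<in> A. u i \<noteq> 0}"
  have "finite B" and "B \<subseteq> A"
    using \<open>finite A\<close> by (auto simp: B_def)
  have sum_B: "(\<Sum>i\<in>A. u i) = (\<Sum>i\<in>B. u i)" "(\<Sum>i\<in>A. u i powr r) = (\<Sum>i\<in>B. u i powr r)"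
    using \<open>finite A\<close> by (auto simp: B_def intro!: sum.mono_neutral_right)
  show ?thesis
  proof (cases "B = {}")
    case True
    then show ?thesis
      by (simp add: sum_B)
  next
    case False
    define k where "k = real (card B)"
    have "0 < k"
      using False \<open>finite B\<close> by (simp add: k_def card_gt_0_iff)
    have "(\<Sum>i\<in>B. (1 / k) *\<^sub>R u i) powr r \<le> (\<Sum>i\<in>B. (1 / k) * u i powr r)"
    proof (rule convex_on_sum[OF \<open>finite B\<close> False powr_convex[OF \<open>1 \<le> r\<close>]])
      show "(\<Sum>i\<in>B. 1 / k) = 1"
        using \<open>0 < k\<close> by (simp add: k_def)
      show "u i \<in> {0<..}" if "i \<in> B" for i
        using that nonneg[of i] by (auto simp: B_def)
    qed (use \<open>0 < k\<close> in auto)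
    then have "(\<Sum>i\<in>B. u i) powr r / k powr r \<le> (\<Sum>i\<in>B. u i powr r) / k"
      using \<open>0 < k\<close> nonneg \<open>B \<subseteq> A\<close>
      by (simp add: powr_divide sum_nonneg subset_iff flip: sum_divide_distrib)
    then have "(\<Sum>i\<in>B. u i) powr r \<le> k powr (r - 1) * (\<Sum>i\<in>B. u i powr r)"
      using \<open>0 < k\<close> by (simp add: field_simps powr_diff)
    \<comment> \<open>The support has at most \<open>card A\<close> elements and r - 1 is
      nonnegative, so the constant may be enlarged to one independent of the support.\<close>
    also have "\<dots> \<le> real (card A) powr (r - 1) * (\<Sum>i\<in>B. u i powr r)"
      using \<open>1 \<le> r\<close> card_mono[OF \<open>finite A\<close> \<open>B \<subseteq> A\<close>]
      by (intro mult_right_mono powr_mono2 sum_nonneg) (auto simp: k_def)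
    finally show ?thesis
      by (simp add: sum_B)
  qed
qed

text \<open>The two power-sum inequalities cover the two ranges: for p \<le> t the convexity bound
  is used with r = t / p on \<open>y i powr p\<close>, otherwise superadditivity with r = p / t on
  \<open>y i powr t\<close>. Writing the exponent as a maximum lets all later steps avoid the case
  split.\<close>

lemma lp_norm_comparison:
  fixes y :: "'i \<Rightarrow> real"
  assumes "finite A" and nonneg: "\<And>i. i \<in> A \<Longrightarrow> 0 \<le> y i" and "0 < p" and "0 < t"
  shows "(\<Sum>i\<in>A. y i powr p) powr (1 / p)
     \<le> real (card A) powr max 0 (1 / p - 1 / t) * (\<Sum>i\<in>A. y i powr t) powr (1 / t)"
proof (cases "A = {}")
  case True
  then show ?thesis
    by simp
next
  case False
  \<comment> \<open>In Isabelle \<open>0 powr 0 = 0\<close>, so a nonzero cardinality is what makes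
    the factor equal to 1 when the maximum is 0.\<close>
  then have card_pos: "0 < real (card A)"
    using \<open>finite A\<close> by (simp add: card_gt_0_iff)
  show ?thesis
  proof (cases "p \<le> t")
    case True
    have "(\<Sum>i\<in>A. y i powr p) powr (t / p)
        \<le> real (card A) powr (t / p - 1) * (\<Sum>i\<in>A. (y i powr p) powr (t / p))"
      using True assms by (intro powr_sum_le_sum_powr) auto
    also have "(\<Sum>i\<in>A. (y i powr p) powr (t / p)) = (\<Sum>i\<in>A. y i powr t)"
      using \<open>0 < p\<close> by (simp add: powr_powr)
    finally have "((\<Sum>i\<in>A. y i powr p) powr (t / p)) powr (1 / t)
        \<le> (real (card A) powr (t / p - 1) * (\<Sum>i\<in>A. y i powr t)) powr (1 / t)"
      using \<open>0 < t\<close> by (intro powr_mono2) auto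
    moreover have "(t / p - 1) * (1 / t) = 1 / p - 1 / t"
      using assms by (simp add: field_simps)
    moreover have "max 0 (1 / p - 1 / t) = 1 / p - 1 / t"
      using True assms by (simp add: field_simps)
    ultimately show ?thesis
      using assms by (simp add: powr_mult powr_powr sum_nonneg)
  next
    case False
    have "(\<Sum>i\<in>A. (y i powr t) powr (p / t)) \<le> (\<Sum>i\<in>A. y i powr t) powr (p / t)"
      using False assms by (intro sum_powr_le_powr_sum) auto
    then have "(\<Sum>i\<in>A. y i powr p) \<le> (\<Sum>i\<in>A. y i powr t) powr (p / t)"
      using assms by (simp add: powr_powr)
    then have "(\<Sum>i\<in>A. y i powr p) powr (1 / p) \<le> ((\<Sum>i\<in>A. y i powr t) powr (p / t)) powr (1 / p)"
      using assms by (intro powr_mono2 sum_nonneg) auto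
    moreover have "max 0 (1 / p - 1 / t) = 0"
      using False assms by (simp add: field_simps)
    ultimately show ?thesis
      using assms card_pos by (simp add: powr_powr)
  qed
qed

lemma dual_unit_ball_nonempty:
  assumes "normed_space_over scE"
  shows "dual_unit_ball scE \<noteq> {}"
proof -
  interpret E: normed_space_over scE
    by fact
  \<comment> \<open>\<open>Vector_Spaces.linear\<close> includes the vector space axioms for both
    sides, so the zero functional is linear only once the scalars are known to form a vector space
    over themselves.\<close>
  have "vector_space ((*) :: 'a \<Rightarrow> 'a \<Rightarrow> 'a)"
    by unfold_locales (simp_all add: algebra_simps)
  then have "(\<lambda>_. 0) \<in> dual_unit_ball scE"
    using E.vector_space_axioms
    by (auto simp: dual_unit_ball_def dual_space_def Vector_Spaces.linear_iff onorm_zero)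
  then show ?thesis
    by blast
qed

text \<open>A functional in the unit ball does not increase norms, so the strong q-norm of the
  family is an upper bound.\<close>

lemma bdd_above_weak_norm:
  assumes "0 < q"
  shows "bdd_above ((\<lambda>\<phi>. (\<Sum>k=1..n. norm (\<phi> (x k)) powr q) powr (1 / q)) ` dual_unit_ball scE)"
proof (rule bdd_aboveI2)
  fix \<phi> assume "\<phi> \<in> dual_unit_ball scE"
  then have \<phi>: "bounded_linear \<phi>" "onorm \<phi> \<le> 1"
    by (auto simp: dual_unit_ball_def dual_space_def)
  have "norm (\<phi> v) \<le> norm v" for v
    using onorm[OF \<phi>(1), of v] mult_right_mono[OF \<phi>(2) norm_ge_zero[of v]] by simp
  then show "(\<Sum>k=1..n. norm (\<phi> (x k)) powr q) powr (1 / q) \<le> (\<Sum>k=1..n. norm (x k) powr q) powr (1 / q)"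
    using assms by (intro powr_mono2 sum_mono sum_nonneg) auto
qed

lemma weak_norm_nonneg:
  assumes "normed_space_over scE" and "0 < q"
  shows "0 \<le> weak_norm scE q n x"
proof -
  obtain \<phi> where "\<phi> \<in> dual_unit_ball scE"
    using dual_unit_ball_nonempty[OF assms(1)] by blast
  then show ?thesis
    unfolding weak_norm_def by (intro cSUP_upper2[OF bdd_above_weak_norm[OF assms(2)]]) auto
qed

lemma weak_norm_comparison:
  assumes "normed_space_over scE" and "0 < s" and "0 < q"
  shows "weak_norm scE s n x \<le> real n powr max 0 (1 / s - 1 / q) * weak_norm scE q n x"
  \<comment> \<open>Only the s-side is unfolded: the factor in n is the same for every \<phi>, so
    the comparison for each \<phi> passes to the supremum.\<close>
  unfolding weak_norm_def[of scE s]
proof (rule cSUP_least[OF dual_unit_ball_nonempty[OF assms(1)]])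
  fix \<phi> assume "\<phi> \<in> dual_unit_ball scE"
  then have "(\<Sum>k=1..n. norm (\<phi> (x k)) powr q) powr (1 / q) \<le> weak_norm scE q n x"
    unfolding weak_norm_def by (rule cSUP_upper[OF _ bdd_above_weak_norm[OF \<open>0 < q\<close>]])
  then have "real n powr max 0 (1 / s - 1 / q) * (\<Sum>k=1..n. norm (\<phi> (x k)) powr q) powr (1 / q)
      \<le> real n powr max 0 (1 / s - 1 / q) * weak_norm scE q n x"
    by (rule mult_left_mono) simp
  with lp_norm_comparison[of "{1..n}" "\<lambda>k. norm (\<phi> (x k))" s q] assms
  show "(\<Sum>k=1..n. norm (\<phi> (x k)) powr s) powr (1 / s)
      \<le> real n powr max 0 (1 / s - 1 / q) * weak_norm scE q n x"
    by simp
qed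

lemma summing_poly_estimate:
  assumes scE: "normed_space_over scE" and P: "P \<in> summing_polys scE scF m t s"
    and pos: "0 < p" "0 < t" "0 < s" "0 < q"
  defines "\<sigma> \<equiv> max 0 (1 / p - 1 / t) + real m * max 0 (1 / s - 1 / q)"
  shows "\<exists>C\<ge>0. \<forall>n\<ge>1. \<forall>x.
    (\<Sum>j=1..n. norm (P (x j)) powr p) powr (1 / p) \<le> C * real n powr \<sigma> * weak_norm scE q n x ^ m"
proof -
  let ?a = "max 0 (1 / p - 1 / t)" and ?b = "max 0 (1 / s - 1 / q)"
  obtain C where "0 \<le> C" and C: "\<And>n x. 1 \<le> n \<Longrightarrow>
      (\<Sum>k=1..n. norm (P (x k)) powr t) powr (1 / t) \<le> C * weak_norm scE s n x ^ m"
    using P unfolding summing_polys_def by blast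
  have "(\<Sum>j=1..n. norm (P (x j)) powr p) powr (1 / p) \<le> C * real n powr \<sigma> * weak_norm scE q n x ^ m"
    if "1 \<le> n" for n x
  proof -
    have "(\<Sum>j=1..n. norm (P (x j)) powr p) powr (1 / p)
        \<le> real n powr ?a * (\<Sum>j=1..n. norm (P (x j)) powr t) powr (1 / t)"
      using lp_norm_comparison[of "{1..n}" "\<lambda>j. norm (P (x j))" p t] pos by simp
    also have "\<dots> \<le> real n powr ?a * (C * weak_norm scE s n x ^ m)"
      using C[OF that] by (intro mult_left_mono) auto
    also have "\<dots> \<le> real n powr ?a * (C * (real n powr ?b * weak_norm scE q n x) ^ m)"
      using weak_norm_comparison[OF scE] weak_norm_nonneg[OF scE] pos \<open>0 \<le> C\<close>
      by (intro mult_left_mono power_mono) auto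
    \<comment> \<open>The second maximum acquires the factor m from the m-th power of the weak norm.
      Since n \<ge> 1, the base is nonzero and the powers combine even for m = 0, which is allowed
      here.\<close>
    also have "\<dots> = C * real n powr \<sigma> * weak_norm scE q n x ^ m"
      using that by (simp add: \<sigma>_def powr_add power_mult_distrib powr_power mult.commute)
    finally show ?thesis .
  qed
  then show ?thesis
    using \<open>0 \<le> C\<close> by blast
qed

lemma pol_index_bounds:
  assumes "normed_space_over scE" and "cont_hom_polys scE scF m \<subseteq> summing_polys scE scF m t s"
    and "0 < p" "0 < t" "0 < s" "0 < q"
  shows "0 \<le> pol_index scE scF m p q"
    and "pol_index scE scF m p q \<le> max 0 (1 / p - 1 / t) + real m * max 0 (1 / s - 1 / q)"
proof -
  let ?\<sigma> = "max 0 (1 / p - 1 / t) + real m * max 0 (1 / s - 1 / q)"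
  let ?S = "{\<sigma>. \<sigma> \<ge> 0 \<and> (\<forall>P\<in>cont_hom_polys scE scF m. \<exists>C\<ge>0. \<forall>n\<ge>1. \<forall>x.
    (\<Sum>j=1..n. norm (P (x j)) powr p) powr (1 / p) \<le> C * real n powr \<sigma> * weak_norm scE q n x ^ m)}"
  have mem: "?\<sigma> \<in> ?S"
    using summing_poly_estimate[OF assms(1) subsetD[OF assms(2)] assms(3-)] by simp
  \<comment> \<open>The real \<open>Inf\<close> of an empty set is unspecified, so even
    nonnegativity of the index rests on having an admissible exponent.\<close>
  then have "?S \<noteq> {}"
    by blast
  then show "0 \<le> pol_index scE scF m p q"
    unfolding pol_index_def by (rule cInf_greatest) auto
  show "pol_index scE scF m p q \<le> ?\<sigma>"
    unfolding pol_index_def by (rule cInf_lower[OF mem]) (auto intro: bdd_belowI)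
qed

theorem proposition1p4:
  fixes scE :: "'k::real_normed_field \<Rightarrow> 'e::banach \<Rightarrow> 'e"
    and scF :: "'k \<Rightarrow> 'f::banach \<Rightarrow> 'f"
    and m :: nat and t s p q :: real
  assumes "normed_space_over scE" and "normed_space_over scF"
    and "m \<ge> 1" and "1 \<le> t" and "1 \<le> s" and "t \<ge> s / real m"
    and "cont_hom_polys scE scF m = summing_polys scE scF m t s"
  shows "(0 < p \<and> p \<le> t \<and> 0 < s \<and> s \<le> q \<longrightarrow>
            pol_index scE scF m p q \<le> 1 / p - 1 / t + real m / s - real m / q) \<and>
         (0 < p \<and> p \<le> t \<and> 0 < q \<and> q \<le> s \<longrightarrow>
            pol_index scE scF m p q \<le> 1 / p - 1 / t) \<and>
         (0 < t \<and> t \<le> p \<and> 0 < s \<and> s \<le> q \<longrightarrow>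
            pol_index scE scF m p q \<le> real m / s - real m / q) \<and>
         (0 < t \<and> t \<le> p \<and> 0 < q \<and> q \<le> s \<longrightarrow>
            pol_index scE scF m p q = 0)"
proof -
  have bounds: "0 \<le> pol_index scE scF m p q"
      "pol_index scE scF m p q \<le> max 0 (1 / p - 1 / t) + real m * max 0 (1 / s - 1 / q)"
    if "0 < p" "0 < q"
    using that assms by (auto intro!: pol_index_bounds[where t = t and s = s])
  have max_le: "max 0 (1 / a - 1 / b) = 1 / a - 1 / b" if "0 < a" "a \<le> b" for a b :: real
    using that by (simp add: field_simps)
  have max_ge: "max 0 (1 / a - 1 / b) = 0" if "0 < b" "b \<le> a" for a b :: real
    using that by (simp add: field_simps)
  have "0 < t" "0 < s"
    using assms by auto
  \<comment> \<open>The inequalities of each case make p and q positive and decide both maxima. In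
    the last case both vanish, and the lower bound gives equality.\<close>
  then show ?thesis
    using bounds by (auto simp: max_le max_ge right_diff_distrib)
qed

end
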